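(* Let $E_1[d],E_2[d],O_1[d],O_2[d]:B_d\to\{0,1,2\}$ ($d\ge1$) be the explicit families of labelings given in the context. Then: (i) there are algorithms which, given $d\ge1$ and $(x,z)\in B_d$, compute the values $E_1[d](x,z)$, $E_2[d](x,z)$, $O_1[d](x,z)$, $O_2[d](x,z)$ in $O(d)$ time; (ii) for every $d\ge1$ and every odd positive integer $y$, $$\text{c-Ulam}[2^dy]=\bigl(\text{c-Ulam}[y-1]\,\widehat{\otimes}\,E_1[d]\bigr)\,\widehat{+}\,\bigl(\text{c-Ulam}[y]\,\widehat{\otimes}\,E_2[d]\bigr)$$ and $$\text{c-Ulam}[2^dy+1]=\bigl(\text{c-Ulam}[y-1]\,\widehat{\otimes}\,O_1[d]\bigr)\,\widehat{+}\,\bigl(\text{c-Ulam}[y]\,\widehat{\otimes}\,O_2[d]\bigr)$$ as labelings of $\mathbb{N}^2$.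
   Context: $\mathbb{N}=\{0,1,2,\dots\}$; $n\bmod m$ denotes the residue of $n$ in $\{0,\dots,m-1\}$. Ulam words are binary words defined recursively: $\mathcal{U}(1)=\{0,1\}$, and for $n>1$, $\mathcal{U}(n)$ is the set of all words of length $n$ over $\{0,1\}$ that are expressible uniquely as a concatenation $uv$ of two distinct words $u\in\mathcal{U}(i)$, $v\in\mathcal{U}(j)$ with $i,j<n$ (i.e. there is exactly one ordered pair $(u,v)$ of such words, $u\ne v$). A word is Ulam if it belongs to $\bigcup_{n\ge1}\mathcal{U}(n)$. $0^m$ denotes a block of $m$ zeros. For an integer $y\ge0$, the labeling $\text{c-Ulam}[y]:\mathbb{N}^2\to\{0,1,2\}$ is defined by letting $\text{c-Ulam}[y](x,z)$ be the minimum of $2$ and the number of representations of $0^x10^y10^z$ as a concatenation of two (not necessarily distinct) Ulam words with exactly one $1$ each, i.e. the number of integers $a$, $0\le a\le y$, such that both $0^x10^a$ and $0^{y-a}10^z$ are Ulam. $B_d=\{0,1,\dots,2^d-1\}^2$. For $m,n\in\{0,1,2\}$: $m\,\widehat{+}\,n=\min(m+n,2)$ and $m\,\widehat{\cdot}\,n=\min(mn,2)$; $\widehat{+}$ is applied pointwise to labelings. For $M:\mathbb{N}^2\to\{0,1,2\}$ and $N:B_d\to\{0,1,2\}$, $M\,\widehat{\otimes}\,N:\mathbb{N}^2\to\{0,1,2\}$ is $(M\,\widehat{\otimes}\,N)(x,z)=M(\lfloor x/2^d\rfloor,\lfloor z/2^d\rfloor)\,\widehat{\cdot}\,N(x\bmod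 2^d,z\bmod 2^d)$. Definition of the labelings, for $d\ge1$ and $(x,z)\in B_d$: - $E_1[d]$: if $x+z\ge2^d-1$, then $E_1[d](x,z)=0$. Otherwise let $e$ be the largest integer $0\le e<d$ with $(x\bmod 2^{e+1})<2^e$ and $(z\bmod 2^{e+1})<2^e$ (such $e$ exists); then $E_1[d](x,z)=2$ if $(x\bmod 2^e)+(z\bmod 2^e)<2^e-1$, and $E_1[d](x,z)=1$ otherwise. - $E_2[d](x,z)=1$ for all $(x,z)$. - $O_1[d]$: if $x+z\ge2^d-2$, then $O_1[d](x,z)=0$. Otherwise, if $x+z$ is even, $O_1[d](x,z)=0$ when $x$ is odd and $O_1[d](x,z)=2$ when $x$ is even. Finally, if $x+z<2^d-2$ and $x+z$ is odd, define $e$ as in the definition of $E_1[d]$; then $O_1[d](x,z)=2$ if $(x\bmod 2^e)+(z\bmod 2^e)<2^e-1$, and $O_1[d](x,z)=1$ otherwise. - $O_2[d]$: if $x+z$ is even, $O_2[d](x,z)=0$ when $x$ is odd and $O_2[d](x,z)=2$ when $x$ is even; if $x+z$ is odd, $O_2[d](x,z)=1$. *)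

theory Defs
  imports Complex_Main "HOL-Library.Landau_Symbols"
begin

section \<open>Ulam words\<close>

text \<open>Binary words are lists of booleans, with \<open>False\<close> for the letter 0 and \<open>True\<close> for the letter 1.\<close>

type_synonym word = "bool list"

context
  notes bex_cong [fundef_cong] conj_cong [fundef_cong]
begin

function Ulam :: "nat \<Rightarrow> word set" where
  "Ulam n =
    (if n = 0 then {}
     else if n = 1 then {[False], [True]}
     else {w. length w = n \<and>
              (\<exists>!(u, v). (\<exists>i\<in>{1..<n}. u \<in> Ulam i) \<and> (\<exists>j\<in>{1..<n}. v \<in> Ulam j) \<and>
                        u \<noteq> v \<and> w = u @ v)})"
  by auto
termination by (relation "measure id") auto

end

declare Ulam.simps [simp del]

definition is_Ulam :: "word \<Rightarrow> bool" where
  "is_Ulam w \<longleftrightarrow> (\<exists>n\<ge>1. w \<in> Ulam n)"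

abbreviation zeros :: "nat \<Rightarrow> word" where
  "zeros m \<equiv> replicate m False"

section \<open>Labelings\<close>

text \<open>
  Labels are natural numbers at most 2. A labeling of \<open>\<nat>\<^sup>2\<close> is a curried function of
  \<open>x\<close> and \<open>z\<close>; a labeling of \<open>B\<^sub>d\<close> is such a function of which only the values at
  \<open>x, z < 2 ^ d\<close> are meaningful.
\<close>

type_synonym labeling = "nat \<Rightarrow> nat \<Rightarrow> nat"

definition cUlam :: "nat \<Rightarrow> labeling" where
  "cUlam y x z = min 2 (card {(u, v).
     is_Ulam u \<and> is_Ulam v \<and> count_list u True = 1 \<and> count_list v True = 1 \<and>
     u @ v = zeros x @ [True] @ zeros y @ [True] @ zeros z})"

definition hat_add :: "nat \<Rightarrow> nat \<Rightarrow> nat" where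
  "hat_add m n = min (m + n) 2"

definition hat_mult :: "nat \<Rightarrow> nat \<Rightarrow> nat" where
  "hat_mult m n = min (m * n) 2"

definition label_add :: "labeling \<Rightarrow> labeling \<Rightarrow> labeling" (infixl "\<oplus>" 65) where
  "(M \<oplus> N) x z = hat_add (M x z) (N x z)"

definition label_tensor :: "labeling \<Rightarrow> nat \<Rightarrow> labeling \<Rightarrow> labeling"
  ("(_ \<otimes>\<^bsub>_\<^esub> _)" [71, 0, 70] 70) where
  "(M \<otimes>\<^bsub>d\<^esub> N) x z = hat_mult (M (x div 2 ^ d) (z div 2 ^ d)) (N (x mod 2 ^ d) (z mod 2 ^ d))"

text \<open>The exponent \<open>e\<close> of the definitions below: a maximum over a set that is nonempty
  whenever \<open>x + z < 2 ^ d - 1\<close>.\<close>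

definition top_exp :: "nat \<Rightarrow> nat \<Rightarrow> nat \<Rightarrow> nat" where
  "top_exp d x z = Max {e. e < d \<and> x mod 2 ^ (e + 1) < 2 ^ e \<and> z mod 2 ^ (e + 1) < 2 ^ e}"

definition E\<^sub>1 :: "nat \<Rightarrow> labeling" where
  "E\<^sub>1 d x z =
    (if x + z \<ge> 2 ^ d - 1 then 0
     else let e = top_exp d x z in
       if x mod 2 ^ e + z mod 2 ^ e < 2 ^ e - 1 then 2 else 1)"

definition E\<^sub>2 :: "nat \<Rightarrow> labeling" where
  "E\<^sub>2 d x z = 1"

definition O\<^sub>1 :: "nat \<Rightarrow> labeling" where
  "O\<^sub>1 d x z =
    (if x + z \<ge> 2 ^ d - 2 then 0
     else if even (x + z) then (if odd x then 0 else 2)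
     else let e = top_exp d x z in
       if x mod 2 ^ e + z mod 2 ^ e < 2 ^ e - 1 then 2 else 1)"

definition O\<^sub>2 :: "nat \<Rightarrow> labeling" where
  "O\<^sub>2 d x z = (if even (x + z) then (if odd x then 0 else 2) else 1)"

section \<open>Multitape Turing machines\<close>

text \<open>
  Deterministic Turing machines with finitely many two-way infinite tapes. Tape symbols are the
  numbers below \<open>nsyms\<close>, with 0 the blank. The states are the numbers up to \<open>nstates\<close>, where 0 is
  the start state and \<open>nstates\<close> the only halting state. Input is read from the first tape and output
  left on the last one.
\<close>

datatype dir = Left | Stay | Right

record tm =
  ntapes :: nat
  nsyms :: nat
  nstates :: nat
  trans_fun :: "nat \<Rightarrow> nat list \<Rightarrow> nat \<times> (nat \<times> dir) list"

text \<open>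
  Well-formedness makes \<open>trans_fun\<close> a finite table: states and symbols stay in
  range. The bound \<open>5 \<le> nsyms\<close> makes room for the input symbols used by \<open>encode\<close> below.
\<close>

definition wf_tm :: "tm \<Rightarrow> bool" where
  "wf_tm M \<longleftrightarrow> 1 \<le> ntapes M \<and> 5 \<le> nsyms M \<and>
    (\<forall>q<nstates M. \<forall>ss. length ss = ntapes M \<and> set ss \<subseteq> {..<nsyms M} \<longrightarrow>
      (case trans_fun M q ss of (q', acts) \<Rightarrow>
        q' \<le> nstates M \<and> length acts = ntapes M \<and> fst ` set acts \<subseteq> {..<nsyms M}))"

text \<open>A tape is its contents together with the position of its head.\<close>

type_synonym tape = "(int \<Rightarrow> nat) \<times> int"

type_synonym config = "nat \<times> tape list"

fun move :: "dir \<Rightarrow> int \<Rightarrow> int" where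
  "move Left p = p - 1"
| "move Stay p = p"
| "move Right p = p + 1"

fun read_tape :: "tape \<Rightarrow> nat" where
  "read_tape (c, p) = c p"

fun act_tape :: "nat \<times> dir \<Rightarrow> tape \<Rightarrow> tape" where
  "act_tape (s, a) (c, p) = (c(p := s), move a p)"

fun step :: "tm \<Rightarrow> config \<Rightarrow> config" where
  "step M (q, ts) =
    (if q < nstates M
     then let (q', acts) = trans_fun M q (map read_tape ts) in (q', map2 act_tape acts ts)
     else (q, ts))"

definition contents :: "nat list \<Rightarrow> int \<Rightarrow> nat" where
  "contents w i = (if 0 \<le> i \<and> nat i < length w then w ! nat i else 0)"

definition init :: "tm \<Rightarrow> nat list \<Rightarrow> config" where
  "init M w = (0, (contents w, 0) # replicate (ntapes M - 1) (contents [], 0))"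

definition computes_within :: "tm \<Rightarrow> nat list \<Rightarrow> nat \<Rightarrow> nat list \<Rightarrow> bool" where
  "computes_within M w t out \<longleftrightarrow>
    (\<exists>n\<le>t. \<exists>ts. (step M ^^ n) (init M w) = (nstates M, ts) \<and> fst (last ts) = contents out)"

text \<open>
  An input consists of \<open>d\<close> and a point of \<open>B\<^sub>d\<close>, whose coordinates are written with exactly \<open>d\<close>
  binary digits each, most significant digit first; so \<open>d\<close> is given by the number of digits. On
  tape, the digit \<open>b\<close> is the symbol \<open>b + 1\<close>, and 4 is a separator; an output label \<open>l\<close> is likewise
  the symbol \<open>l + 1\<close>.
\<close>

definition digits :: "nat \<Rightarrow> nat \<Rightarrow> nat list" where
  "digits d n = map (\<lambda>i. n div 2 ^ i mod 2) (rev [0..<d])"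

definition encode :: "nat \<Rightarrow> nat \<Rightarrow> nat \<Rightarrow> nat list" where
  "encode d x z = map Suc (digits d x) @ [4] @ map Suc (digits d z)"

text \<open>A single machine has to work for all \<open>d\<close>.\<close>

definition linear_time_computable :: "(nat \<Rightarrow> labeling) \<Rightarrow> bool" where
  "linear_time_computable F \<longleftrightarrow>
    (\<exists>M T. wf_tm M \<and> (\<lambda>d. real (T d)) \<in> O(\<lambda>d. real d) \<and>
      (\<forall>d\<ge>1. \<forall>x<2 ^ d. \<forall>z<2 ^ d. computes_within M (encode d x z) (T d) [Suc (F d x z)]))"

end

theory Submission
  imports Defs
begin

text \<open>
  The only Ulam word without a 1 is 0 itself, so a word \<open>0\<^sup>x10\<^sup>z\<close> splits into Ulam words only by
  detaching a 0 at either end. Therefore being Ulam follows Pascal's rule modulo 2: it means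
  that \<open>x\<close> and \<open>z\<close> have no common binary digit 1. Hence c-Ulam counts the pairs \<open>a + b = y\<close> with \<open>a\<close> disjoint from \<open>x\<close> and \<open>b\<close> disjoint from \<open>z\<close>.
  For a sum \<open>2 ^ d * y\<close>, the low parts of \<open>a\<close> and \<open>b\<close> add up to \<open>0\<close> (in one way) or to \<open>2 ^ d\<close> (then
  the high parts add up to \<open>y - 1\<close>), which gives the two summands of the identity; for
  \<open>2 ^ d * y + 1\<close> the lowest bit contributes a factor. The low counts obey a recursion on the
  binary digits, so after truncation at 2 they are computed by a finite automaton reading the
  digits of \<open>x\<close> and \<open>z\<close> in parallel.
\<close>

section \<open>Ulam words with one 1\<close>

abbreviation disjoint_bits :: "nat \<Rightarrow> nat \<Rightarrow> bool" where
  "disjoint_bits x z \<equiv> and x z = 0"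

lemma disjoint_bits_rec:
  "disjoint_bits x z \<longleftrightarrow> \<not> (odd x \<and> odd z) \<and> disjoint_bits (x div 2) (z div 2)"
  by (subst and_rec) auto

text \<open>This is Pascal's rule modulo 2, since disjoint digits mean that the binomial coefficient
  of \<open>x + z\<close> over \<open>x\<close> is odd. If \<open>x\<close> and \<open>z\<close> are
  both odd, it passes to the halves; otherwise one of the three pairs shares a last digit 1 and the
  other two have equal halves.\<close>

lemma disjoint_bits_Suc_Suc:
  "disjoint_bits (Suc x) (Suc z) \<longleftrightarrow> disjoint_bits x (Suc z) \<noteq> disjoint_bits (Suc x) z"
proof (induction "x + z" arbitrary: x z rule: less_induct)
  case less
  show ?case
  proof (cases "odd x \<and> odd z")
    case True
    then obtain a b where [simp]: "x = 2 * a + 1" "z = 2 * b + 1" by (auto elim!: oddE)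
    have "disjoint_bits (Suc a) (Suc b) \<longleftrightarrow> disjoint_bits a (Suc b) \<noteq> disjoint_bits (Suc a) b"
      by (rule less) simp
    then show ?thesis
      unfolding disjoint_bits_rec[of "Suc x" "Suc z"] disjoint_bits_rec[of x "Suc z"]
        disjoint_bits_rec[of "Suc x" z] by simp
  next
    case False
    have "x = 2 * (x div 2) \<or> x = 2 * (x div 2) + 1" "z = 2 * (z div 2) \<or> z = 2 * (z div 2) + 1"
      by presburger+
    then obtain a b where "x = 2 * a \<or> x = 2 * a + 1" "z = 2 * b \<or> z = 2 * b + 1"
      by blast
    with False show ?thesis
      unfolding disjoint_bits_rec[of "Suc x" "Suc z"] disjoint_bits_rec[of x "Suc z"]
        disjoint_bits_rec[of "Suc x" z] by (elim disjE) simp_all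
  qed
qed

section \<open>The recursive definition of Ulam words\<close>

lemma length_Ulam: "w \<in> Ulam n \<Longrightarrow> length w = n"
  by (subst (asm) Ulam.simps) (auto split: if_splits)

lemma is_Ulam_iff_length: "is_Ulam w \<longleftrightarrow> w \<noteq> [] \<and> w \<in> Ulam (length w)"
  unfolding is_Ulam_def by (auto dest: length_Ulam simp: Suc_le_eq)

lemma is_Ulam_singleton: "is_Ulam [b]"
  by (cases b) (auto simp: is_Ulam_iff_length Ulam.simps)

lemma not_is_Ulam_Nil: "\<not> is_Ulam []"
  by (simp add: is_Ulam_iff_length)

lemma is_Ulam_iff:
  assumes "length w \<ge> 2"
  shows "is_Ulam w \<longleftrightarrow> (\<exists>!(u, v). is_Ulam u \<and> is_Ulam v \<and> u \<noteq> v \<and> w = u @ v)"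
proof -
  let ?n = "length w"
  \<comment> \<open>The length bounds come for free: neither factor is empty, so both are shorter
    than \<open>w\<close>.\<close>
  have *: "(\<exists>i\<in>{1..<?n}. u \<in> Ulam i) \<and> (\<exists>j\<in>{1..<?n}. v \<in> Ulam j) \<and> u \<noteq> v \<and> w = u @ v \<longleftrightarrow>
      is_Ulam u \<and> is_Ulam v \<and> u \<noteq> v \<and> w = u @ v" for u v
  proof -
    have "(\<exists>i\<in>{1..<?n}. u \<in> Ulam i) \<longleftrightarrow> is_Ulam u \<and> length u < ?n" for u
      unfolding is_Ulam_def by (metis atLeastLessThan_iff length_Ulam)
    then show ?thesis using not_is_Ulam_Nil by auto
  qed
  have "is_Ulam w \<longleftrightarrow> w \<in> Ulam ?n"
    using assms by (auto simp: is_Ulam_iff_length)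
  also have "\<dots> \<longleftrightarrow> (\<exists>!(u, v). (\<exists>i\<in>{1..<?n}. u \<in> Ulam i) \<and> (\<exists>j\<in>{1..<?n}. v \<in> Ulam j) \<and>
      u \<noteq> v \<and> w = u @ v)"
    using assms by (subst Ulam.simps) auto
  finally show ?thesis unfolding * .
qed

text \<open>Both factors of a longer block would by induction be the one-letter word, but factors
  must differ.\<close>

lemma is_Ulam_zeros: "is_Ulam (zeros m) \<longleftrightarrow> m = 1"
proof (induction m rule: less_induct)
  case (less m)
  show ?case
  proof (cases "m \<ge> 2")
    case True
    have "\<not> (is_Ulam u \<and> is_Ulam v \<and> u \<noteq> v \<and> zeros m = u @ v)" for u v
    proof
      assume *: "is_Ulam u \<and> is_Ulam v \<and> u \<noteq> v \<and> zeros m = u @ v"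
      then have m: "m = length u + length v"
        by (metis length_append length_replicate)
      have u: "u = zeros (length u)" and v: "v = zeros (length v)"
        using * by (metis Un_iff in_set_replicate replicate_eqI set_append)+
      have "u \<noteq> []" "v \<noteq> []" using * not_is_Ulam_Nil by auto
      then have "length u = 1" "length v = 1"
        using less[of "length u"] less[of "length v"] * m u v by auto
      then show False using * u v by metis
    qed
    then show ?thesis using True by (subst is_Ulam_iff) auto
  next
    case False
    then have "m = 0 \<or> m = 1" by auto
    then show ?thesis by (auto simp: not_is_Ulam_Nil is_Ulam_singleton)
  qed
qed

abbreviation one_word :: "nat \<Rightarrow> nat \<Rightarrow> word" where
  "one_word x z \<equiv> zeros x @ True # zeros z"

lemma zeros_append_True_eq_iff:
  "zeros x @ True # u = zeros y @ True # v \<longleftrightarrow> x = y \<and> u = v"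
proof (induction x arbitrary: y)
  case 0 then show ?case by (cases y) auto
next
  case (Suc x) then show ?case by (cases y) auto
qed

lemma one_word_eq_iff: "one_word x z = one_word x' z' \<longleftrightarrow> x = x' \<and> z = z'"
  by (simp add: zeros_append_True_eq_iff)

text \<open>The cut falls either before the 1 or after it.\<close>

lemma one_word_eq_append_iff:
  "one_word x z = u @ v \<longleftrightarrow>
    (\<exists>k\<le>x. u = zeros k \<and> v = one_word (x - k) z) \<or>
    (\<exists>k\<le>z. u = one_word x k \<and> v = zeros (z - k))" (is "?L \<longleftrightarrow> ?R")
proof
  assume L: ?L
  show ?R
  proof (cases "length u \<le> x")
    case True
    have "u = take (length u) (one_word x z)" "v = drop (length u) (one_word x z)"
      using L by simp_all
    with True show ?thesis by (intro disjI1 exI[of _ "length u"]) (simp add: min_def)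
  next
    case False
    then obtain k where k: "length u = Suc (x + k)" by (metis less_imp_Suc_add not_le)
    have "k \<le> z" using arg_cong[OF L, of length] k by simp
    have "u = take (length u) (one_word x z)" "v = drop (length u) (one_word x z)"
      using L by simp_all
    with k \<open>k \<le> z\<close> show ?thesis by (intro disjI2 exI[of _ k]) (simp add: min_def)
  qed
next
  assume ?R
  then show ?L by (auto simp flip: replicate_add append_assoc)
      (auto simp: simp flip: replicate_add)
qed

lemma is_Ulam_one_word: "is_Ulam (one_word x z) \<longleftrightarrow> disjoint_bits x z"
proof (induction "x + z" arbitrary: x z rule: less_induct)
  case less
  let ?A = "x \<noteq> 0 \<and> is_Ulam (one_word (x - 1) z)"
  let ?B = "z \<noteq> 0 \<and> is_Ulam (one_word x (z - 1))"
  show ?case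
  proof (cases "x = 0 \<and> z = 0")
    case True
    then show ?thesis by (simp add: is_Ulam_singleton)
  next
    case False
    \<comment> \<open>Makes the two factors distinct, and the two candidate decompositions different
      pairs.\<close>
    have one_ne: "one_word a b \<noteq> [False]" for a b by (cases a) auto
    have *: "is_Ulam u \<and> is_Ulam v \<and> u \<noteq> v \<and> one_word x z = u @ v \<longleftrightarrow>
        ?A \<and> u = [False] \<and> v = one_word (x - 1) z \<or>
        ?B \<and> u = one_word x (z - 1) \<and> v = [False]" (is "?L u v \<longleftrightarrow> ?R u v") for u v
    proof
      assume L: "?L u v"
      from L consider k where "k \<le> x" "u = zeros k" "v = one_word (x - k) z"
        | k where "k \<le> z" "u = one_word x k" "v = zeros (z - k)"
        unfolding one_word_eq_append_iff by blast
      then show "?R u v"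
      proof cases
        case 1 then show ?thesis using L by (auto simp: is_Ulam_zeros)
      next
        case 2
        then have "z - k = 1" using L by (auto simp: is_Ulam_zeros)
        then have "k = z - 1" "z \<noteq> 0" by auto
        with 2 L show ?thesis by auto
      qed
    next
      assume "?R u v"
      then show "?L u v"
      proof (elim disjE conjE)
        assume "x \<noteq> 0" "is_Ulam (one_word (x - 1) z)" "u = [False]" "v = one_word (x - 1) z"
        then show ?thesis using one_ne[of "x - 1" z]
          by (cases x) (auto simp: is_Ulam_singleton)
      next
        assume "z \<noteq> 0" "is_Ulam (one_word x (z - 1))" "u = one_word x (z - 1)" "v = [False]"
        then show ?thesis using one_ne[of x "z - 1"]
          by (cases z) (auto simp: is_Ulam_singleton replicate_append_same)
      qed
    qed
    have "is_Ulam (one_word x z) \<longleftrightarrow> (\<exists>!(u, v). ?R u v)"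
      using False by (subst is_Ulam_iff) (simp_all only: *, auto)
    \<comment> \<open>Two valid shortenings would give two decompositions, so uniqueness is
      exclusive or.\<close>
    also have "\<dots> \<longleftrightarrow> ?A \<noteq> ?B"
      using one_ne by (auto simp: Ex1_def)
    also have "\<dots> \<longleftrightarrow> disjoint_bits x z"
    proof (cases x)
      case 0 
      then show ?thesis using False less[of 0 "z - 1"] by auto
    next
      case x: (Suc x')
      show ?thesis
      proof (cases z)
        case 0
        then show ?thesis using x less[of "x - 1" 0] by auto
      next
        case (Suc z')
        then show ?thesis using x less[of x' z] less[of x z'] disjoint_bits_Suc_Suc[of x' z'] by auto
      qed
    qed
    finally show ?thesis .
  qed
qed

lemma count_list_True_eq_1_iff: "count_list u True = 1 \<longleftrightarrow> (\<exists>x z. u = one_word x z)"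
proof
  assume *: "count_list u True = 1"
  then have "True \<in> set u" using count_notin by fastforce
  then obtain a b where u: "u = a @ True # b" by (meson split_list)
  with * have "count_list a True = 0" "count_list b True = 0" by auto
  then have "a = zeros (length a)" "b = zeros (length b)"
    by (metis (full_types) count_list_0_iff replicate_eqI)+
  with u have "u = one_word (length a) (length b)" by metis
  then show "\<exists>x z. u = one_word x z" by blast
qed auto

section \<open>Counting decompositions\<close>

text \<open>The count before truncation at 2, so that recursions hold as exact equations;
  \<open>a\<close> counts the middle zeros given to the left factor.\<close>

definition splits :: "nat \<Rightarrow> nat \<Rightarrow> nat \<Rightarrow> nat" where
  "splits y x z = (\<Sum>a\<le>y. of_bool (disjoint_bits a x \<and> disjoint_bits (y - a) z))"

lemma cUlam_eq_splits: "cUlam y x z = min 2 (splits y x z)"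
proof -
  let ?S = "{a \<in> {..y}. disjoint_bits a x \<and> disjoint_bits (y - a) z}"
  let ?f = "\<lambda>a. (one_word x a, one_word (y - a) z)"
  have "{(u, v). is_Ulam u \<and> is_Ulam v \<and> count_list u True = 1 \<and> count_list v True = 1 \<and>
     u @ v = zeros x @ [True] @ zeros y @ [True] @ zeros z} = ?f ` ?S" (is "?L = _")
  proof (intro equalityI subsetI)
    fix p assume "p \<in> ?L"
    then obtain u v where p: "p = (u, v)" "is_Ulam u" "is_Ulam v"
      "count_list u True = 1" "count_list v True = 1"
      "u @ v = zeros x @ [True] @ zeros y @ [True] @ zeros z" by auto
    then obtain a b r s where uv: "u = one_word a b" "v = one_word r s"
      unfolding count_list_True_eq_1_iff by blast
    have "zeros a @ True # zeros (b + r) @ True # zeros s =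
        zeros x @ True # zeros y @ True # zeros z"
      using p(6) unfolding uv by (simp add: replicate_add)
    then have "a = x" "b + r = y" "s = z" by (auto simp: zeros_append_True_eq_iff)
    with p uv show "p \<in> ?f ` ?S"
      by (auto simp: is_Ulam_one_word and.commute intro!: image_eqI[of _ _ b])
  next
    fix p assume "p \<in> ?f ` ?S"
    then obtain a where a: "a \<in> ?S" "p = ?f a" by blast
    then have "zeros y = zeros a @ zeros (y - a)" by (simp flip: replicate_add)
    with a show "p \<in> ?L" by (auto simp: is_Ulam_one_word and.commute)
  qed
  moreover have "inj_on ?f ?S" by (rule inj_onI) (simp add: one_word_eq_iff)
  ultimately have "card ?L = card ?S" by (simp add: card_image)
  then show ?thesis unfolding cUlam_def splits_def
    by (simp add: sum.inter_filter[symmetric] of_bool_def)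
qed

section \<open>Recursion of the counts on the lowest digit\<close>

lemma sum_atMost_double:
  fixes f :: "nat \<Rightarrow> nat"
  shows "(\<Sum>a\<le>2 * y. f a) = (\<Sum>a\<le>y. f (2 * a)) + (\<Sum>a<y. f (2 * a + 1))"
  by (induction y) simp_all

text \<open>An odd sum has exactly one odd summand; the two terms tell whether the left one,
  respectively the right one, may be odd.\<close>

definition even_count :: "nat \<Rightarrow> nat \<Rightarrow> nat" where
  "even_count x z = of_bool (even x) + of_bool (even z)"

text \<open>The last digits of the summands are 0 and 1, so they produce no carry and the halves add
  up to \<open>y\<close>.\<close>

lemma splits_odd:
  "splits (2 * y + 1) x z = even_count x z * splits y (x div 2) (z div 2)"
proof -
  define f where "f a = (of_bool (disjoint_bits a x \<and> disjoint_bits (2 * y + 1 - a) z) :: nat)" for a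
  define g where "g a = (of_bool (disjoint_bits a (x div 2) \<and> disjoint_bits (y - a) (z div 2)) :: nat)" for a
  have f: "f (2 * a) = of_bool (even z) * g a" "f (2 * a + 1) = of_bool (even x) * g a" if "a \<le> y" for a
  proof -
    from that have "2 * y + 1 - 2 * a = 2 * (y - a) + 1" "2 * y + 1 - (2 * a + 1) = 2 * (y - a)" by simp_all
    then show "f (2 * a) = of_bool (even z) * g a" "f (2 * a + 1) = of_bool (even x) * g a"
      unfolding f_def g_def using disjoint_bits_rec[of "2 * a" x] disjoint_bits_rec[of "2 * a + 1" x]
       disjoint_bits_rec[of "2 * (y - a)" z] disjoint_bits_rec[of "2 * (y - a) + 1" z] by auto
  qed
  have "splits (2 * y + 1) x z = (\<Sum>a\<le>2 * y. f a) + f (2 * y + 1)"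
    by (simp add: splits_def f_def)
  also have "\<dots> = (\<Sum>a\<le>y. f (2 * a)) + ((\<Sum>a<y. f (2 * a + 1)) + f (2 * y + 1))"
    unfolding sum_atMost_double by simp
  also have "(\<Sum>a<y. f (2 * a + 1)) + f (2 * y + 1) = (\<Sum>a\<le>y. f (2 * a + 1))"
    by (simp flip: lessThan_Suc_atMost)
  also have "(\<Sum>a\<le>y. f (2 * a)) + (\<Sum>a\<le>y. f (2 * a + 1)) = even_count x z * (\<Sum>a\<le>y. g a)"
    using f by (simp add: sum_distrib_left even_count_def algebra_simps)
  finally show ?thesis by (simp add: splits_def g_def)
qed

text \<open>Either both summands are even and their halves add up to \<open>y\<close>, or both are
  odd and the carry leaves \<open>y - 1\<close> for the halves.\<close>

lemma splits_double:
  assumes "y > 0"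
  shows "splits (2 * y) x z =
    splits y (x div 2) (z div 2) + of_bool (even x \<and> even z) * splits (y - 1) (x div 2) (z div 2)"
proof -
  define f where "f a = (of_bool (disjoint_bits a x \<and> disjoint_bits (2 * y - a) z) :: nat)" for a
  define g where "g y a = (of_bool (disjoint_bits a (x div 2) \<and> disjoint_bits (y - a) (z div 2)) :: nat)" for y a
  have 1: "f (2 * a) = g y a" for a
  proof -
    have "2 * y - 2 * a = 2 * (y - a)" by simp
    then show ?thesis unfolding f_def g_def
      using disjoint_bits_rec[of "2 * a" x] disjoint_bits_rec[of "2 * (y - a)" z] by auto
  qed
  have 2: "f (2 * a + 1) = of_bool (even x \<and> even z) * g (y - 1) a" if "a < y" for a
  proof -
    from that have "2 * y - (2 * a + 1) = 2 * (y - 1 - a) + 1" by simp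
    then show ?thesis unfolding f_def g_def
      using disjoint_bits_rec[of "2 * a + 1" x] disjoint_bits_rec[of "2 * (y - 1 - a) + 1" z] by auto
  qed
  have "splits (2 * y) x z = (\<Sum>a\<le>y. f (2 * a)) + (\<Sum>a<y. f (2 * a + 1))"
    unfolding splits_def f_def[symmetric] sum_atMost_double ..
  also have "\<dots> = (\<Sum>a\<le>y. g y a) + of_bool (even x \<and> even z) * (\<Sum>a<y. g (y - 1) a)"
    using 1 2 by (simp add: sum_distrib_left)
  \<comment> \<open>For \<open>y = 0\<close> truncated subtraction would add a term to the empty
    sum.\<close>
  also have "{..<y} = {..y - 1}" using assms by auto
  finally show ?thesis by (simp add: splits_def g_def)
qed

text \<open>The numbers of pairs \<open>(a, b)\<close>, disjoint from \<open>x\<close> and \<open>z\<close> in the \<open>d\<close> low bits, with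
  \<open>a, b < 2 ^ d\<close> and sum \<open>2 ^ d - 1\<close>, respectively \<open>2 ^ d\<close>.\<close>

fun full_splits :: "nat \<Rightarrow> nat \<Rightarrow> nat \<Rightarrow> nat" where
  "full_splits 0 x z = 1"
| "full_splits (Suc d) x z = even_count x z * full_splits d (x div 2) (z div 2)"

fun carry_splits :: "nat \<Rightarrow> nat \<Rightarrow> nat \<Rightarrow> nat" where
  "carry_splits 0 x z = 0"
| "carry_splits (Suc d) x z = carry_splits d (x div 2) (z div 2) +
     of_bool (even x \<and> even z) * full_splits d (x div 2) (z div 2)"

text \<open>The number ends in \<open>d\<close> binary ones, so \<open>splits_odd\<close> applies
  \<open>d\<close> times.\<close>

lemma splits_power_minus_1:
  assumes "y > 0"
  shows "splits (2 ^ d * y - 1) x z =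
    full_splits d x z * splits (y - 1) (x div 2 ^ d) (z div 2 ^ d)"
proof (induction d arbitrary: x z)
  case (Suc d)
  have "2 ^ d * y > 0" "2 ^ Suc d * y = 2 * (2 ^ d * y)" using assms by simp_all
  then have "2 ^ Suc d * y - 1 = 2 * (2 ^ d * y - 1) + 1" by linarith
  then show ?case by (simp only: splits_odd Suc full_splits.simps) (simp add: div_mult2_eq)
qed simp

text \<open>While the last digits of the summands are zeros, a multiple of the remaining power is
  left. The first pair of ones causes a carry and leaves one less than such a multiple, as in
  \<open>splits_power_minus_1\<close>.\<close>

lemma splits_power:
  assumes "y > 0"
  shows "splits (2 ^ d * y) x z = splits y (x div 2 ^ d) (z div 2 ^ d) +
    carry_splits d x z * splits (y - 1) (x div 2 ^ d) (z div 2 ^ d)"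
proof (induction d arbitrary: x z)
  case (Suc d)
  have pos: "2 ^ d * y > 0" using assms by simp
  have "splits (2 ^ Suc d * y) x z = splits (2 * (2 ^ d * y)) x z"
    by (simp only: power_Suc mult.assoc)
  also have "\<dots> = splits (2 ^ d * y) (x div 2) (z div 2) +
      of_bool (even x \<and> even z) * splits (2 ^ d * y - 1) (x div 2) (z div 2)"
    by (rule splits_double[OF pos])
  also have "\<dots> = splits y (x div 2 ^ Suc d) (z div 2 ^ Suc d) +
      carry_splits (Suc d) x z * splits (y - 1) (x div 2 ^ Suc d) (z div 2 ^ Suc d)"
    unfolding Suc splits_power_minus_1[OF assms] by (simp add: div_mult2_eq algebra_simps)
  finally show ?case .
qed simp

section \<open>Dependence on the low digits only\<close>

lemma even_count_mod: "even_count (x mod 2 ^ Suc d) (z mod 2 ^ Suc d) = even_count x z"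
  by (simp add: even_count_def dvd_mod_iff)

lemma mod_power_Suc:
  "x mod 2 ^ Suc e = 2 * (x div 2 mod 2 ^ e) + x mod 2" for x :: nat
  using mod_mult2_eq[of x 2 "2 ^ e"] by simp

lemma mod_power_Suc_div_2: "x mod 2 ^ Suc d div 2 = x div 2 mod 2 ^ d" for x :: nat
  by (simp add: mod_power_Suc del: power_Suc)

lemma full_splits_mod: "full_splits d (x mod 2 ^ d) (z mod 2 ^ d) = full_splits d x z"
  by (induction d arbitrary: x z)
    (simp_all add: even_count_mod mod_power_Suc_div_2 del: power_Suc)

lemma carry_splits_mod: "carry_splits d (x mod 2 ^ d) (z mod 2 ^ d) = carry_splits d x z"
  by (induction d arbitrary: x z)
    (simp_all add: full_splits_mod mod_power_Suc_div_2 dvd_mod_iff del: power_Suc)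

section \<open>The explicit labelings\<close>

definition common_zeros :: "nat \<Rightarrow> nat \<Rightarrow> nat \<Rightarrow> nat set" where
  "common_zeros d x z = {e. e < d \<and> even (x div 2 ^ e) \<and> even (z div 2 ^ e)}"

text \<open>Digit \<open>e\<close> is the top digit of the residue, and its weight
  \<open>2 ^ e\<close> exceeds the rest.\<close>

lemma mod_power_less_iff: "x mod 2 ^ (e + 1) < 2 ^ e \<longleftrightarrow> even (x div 2 ^ e)" for x :: nat
proof -
  have "x mod 2 ^ (e + 1) = 2 ^ e * (x div 2 ^ e mod 2) + x mod 2 ^ e"
    using mod_mult2_eq[of x "2 ^ e" 2] by (simp add: mult.commute)
  moreover have "x mod 2 ^ e < 2 ^ e" by simp
  ultimately show ?thesis by (cases "even (x div 2 ^ e)") (auto simp: odd_iff_mod_2_eq_one)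
qed

lemma top_exp_eq: "top_exp d x z = Max (common_zeros d x z)"
  unfolding top_exp_def common_zeros_def mod_power_less_iff ..

lemma finite_common_zeros [simp]: "finite (common_zeros d x z)"
  by (simp add: common_zeros_def)

lemma common_zeros_Suc:
  "common_zeros (Suc d) x z = Suc ` common_zeros d (x div 2) (z div 2) \<union>
     (if even x \<and> even z then {0} else {})"
proof (rule set_eqI)
  fix e show "e \<in> common_zeros (Suc d) x z \<longleftrightarrow> e \<in> Suc ` common_zeros d (x div 2) (z div 2) \<union>
     (if even x \<and> even z then {0} else {})"
    by (cases e) (auto simp: common_zeros_def div_mult2_eq)
qed

text \<open>Halving shifts positions down by one; a common zero at position 0 is not the largest,
  because a higher one exists.\<close>

lemma top_exp_Suc:
  assumes "common_zeros d (x div 2) (z div 2) \<noteq> {}"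
  shows "top_exp (Suc d) x z = Suc (top_exp d (x div 2) (z div 2))"
proof -
  have "Max (Suc ` common_zeros d (x div 2) (z div 2)) = Suc (Max (common_zeros d (x div 2) (z div 2)))"
    using assms by (intro mono_Max_commute[symmetric]) (auto intro: monoI)
  then show ?thesis using assms by (simp add: top_exp_eq common_zeros_Suc)
qed

text \<open>From the top digit down, a pair multiplies \<open>full_splits\<close> by its number of
  zeros, and a common zero first adds the current \<open>full_splits\<close> to
  \<open>carry_splits\<close>. Comparing \<open>x + z + 1\<close> with \<open>2 ^ d\<close> reveals
  the first pair that is not complementary: two ones if it is larger, two zeros if smaller. In the
  latter case this pair is at \<open>top_exp\<close>, and the same comparison below it finds the
  next one.\<close>

lemma splits_invariant:
  assumes "x < 2 ^ d" "z < 2 ^ d"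
  shows "(x + z + 1 > 2 ^ d \<longrightarrow> carry_splits d x z = 0 \<and> full_splits d x z = 0) \<and>
    (x + z + 1 = 2 ^ d \<longrightarrow> carry_splits d x z = 0 \<and> full_splits d x z = 1 \<and> common_zeros d x z = {}) \<and>
    (x + z + 1 < 2 ^ d \<longrightarrow> common_zeros d x z \<noteq> {} \<and>
      (let e = top_exp d x z; s = x mod 2 ^ e + z mod 2 ^ e + 1 in
        (s > 2 ^ e \<longrightarrow> carry_splits d x z = 1 \<and> full_splits d x z = 0) \<and>
        (s = 2 ^ e \<longrightarrow> carry_splits d x z = 1 \<and> full_splits d x z = 2) \<and>
        (s < 2 ^ e \<longrightarrow> carry_splits d x z \<ge> 2)))"
  using assms
proof (induction d arbitrary: x z)
  case 0
  then show ?case by (simp add: common_zeros_def)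
next
  case (Suc d)
  define a b i j where abij: "a = x div 2" "b = z div 2" "i = x mod 2" "j = z mod 2"
  have xz: "x = 2 * a + i" "z = 2 * b + j" unfolding abij by simp_all
  have ij: "i = 0 \<or> i = 1" "j = 0 \<or> j = 1" unfolding abij by auto
  have par: "even x \<longleftrightarrow> i = 0" "even z \<longleftrightarrow> j = 0" unfolding abij by (auto simp: even_iff_mod_2_eq_zero)
  have dv: "x div 2 = a" "z div 2 = b" by (simp_all add: abij)
  have "a < 2 ^ d" "b < 2 ^ d" using Suc.prems unfolding abij by auto
  note IH = Suc.IH[OF this]
  note rec = carry_splits.simps(2)[of d x z] full_splits.simps(2)[of d x z] common_zeros_Suc[of d x z]
    even_count_def[of x z]
  note rec' = rec[unfolded par dv]
  consider "a + b + 1 > 2 ^ d" | "a + b + 1 = 2 ^ d" | "a + b + 1 < 2 ^ d" by linarith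
  then show ?case
  proof cases
    case 1
    then have "x + z + 1 > 2 ^ Suc d" unfolding xz by simp
    then show ?thesis using 1 IH rec' by auto
  next
    case 2
    then have *: "carry_splits d a b = 0" "full_splits d a b = 1" "common_zeros d a b = {}" 
      using IH by auto
    have eq: "x + z + 1 = 2 ^ Suc d - 1 + i + j" unfolding xz using 2 by simp
    have pos: "2 ^ Suc d \<ge> (2::nat)" by simp
    \<comment> \<open>All higher pairs are complementary, so the last pair decides. Two zeros make 0
      the top exponent, where the residues vanish and the compared sum is
      \<open>1 = 2 ^ 0\<close>.\<close>
    consider "i = 0" "j = 0" | "i + j = 1" | "i = 1" "j = 1" using ij by auto
    then show ?thesis
    proof cases
      case 1
      then have "common_zeros (Suc d) x z = {0}" using * rec' by auto
      then have "top_exp (Suc d) x z = 0" unfolding top_exp_eq by simp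
      with 1 show ?thesis using eq pos rec' * by auto
    next
      case 2
      then show ?thesis using eq pos rec' * by auto
    next
      case 3
      then show ?thesis using eq pos rec' * by auto
    qed
  next
    case 3
    define e where "e = top_exp d a b"
    have lt: "x + z + 1 < 2 ^ Suc d" unfolding xz using ij 3 by auto
    have ne: "common_zeros d a b \<noteq> {}" using 3 IH by auto
    then have te: "top_exp (Suc d) x z = Suc e" using top_exp_Suc[of d x z] by (simp add: dv e_def)
    define s where "s = a mod 2 ^ e + b mod 2 ^ e + 1"
    \<comment> \<open>The new sum is \<open>2 * (s - 1) + i + j + 1\<close>. As \<open>i + j\<close>
      is at most 2, strict inequalities between \<open>s\<close> and \<open>2 ^ e\<close> survive;
      only equality depends on the new pair.\<close>
    have sum: "x mod 2 ^ Suc e + z mod 2 ^ Suc e + 1 = 2 * s - 1 + i + j"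
      unfolding mod_power_Suc s_def by (simp add: abij)
    have s: "(s > 2 ^ e \<longrightarrow> carry_splits d a b = 1 \<and> full_splits d a b = 0) \<and>
        (s = 2 ^ e \<longrightarrow> carry_splits d a b = 1 \<and> full_splits d a b = 2) \<and>
        (s < 2 ^ e \<longrightarrow> carry_splits d a b \<ge> 2)"
      using 3 IH unfolding Let_def e_def[symmetric] s_def[symmetric] by blast
    have sp: "s \<ge> 1" by (simp add: s_def)
    have ne': "common_zeros (Suc d) x z \<noteq> {}" using ne rec' by auto
    consider "s > 2 ^ e" | "s = 2 ^ e" | "s < 2 ^ e" by linarith
    then have "(2 * s - 1 + i + j > 2 ^ Suc e \<longrightarrow> carry_splits (Suc d) x z = 1 \<and> full_splits (Suc d) x z = 0) \<and>
        (2 * s - 1 + i + j = 2 ^ Suc e \<longrightarrow> carry_splits (Suc d) x z = 1 \<and> full_splits (Suc d) x z = 2) \<and>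
        (2 * s - 1 + i + j < 2 ^ Suc e \<longrightarrow> carry_splits (Suc d) x z \<ge> 2)"
    proof cases
      case 1
      then have "2 * s - 1 + i + j > 2 ^ Suc e" by simp
      then show ?thesis using 1 s rec' by auto
    next
      case 2
      \<comment> \<open>Two ones set \<open>full_splits\<close> to 0, a mixed pair keeps both
        counts, and two zeros add 2 to \<open>carry_splits\<close>.\<close>
      moreover have "2 * 2 ^ e - Suc 0 \<noteq> 2 * 2 ^ e" using 2 sp by linarith
      ultimately show ?thesis using s rec' ij by auto
    next
      case 3
      then have "2 * s - 1 + i + j < 2 ^ Suc e" using ij sp by auto
      then show ?thesis using 3 s rec' by auto
    qed
    then show ?thesis using lt ne' unfolding te Let_def sum by auto
  qed
qed

lemma E\<^sub>1_eq_carry_splits: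
  assumes "x < 2 ^ d" "z < 2 ^ d"
  shows "E\<^sub>1 d x z = min 2 (carry_splits d x z)"
proof (cases "x + z + 1 < 2 ^ d")
  case True
  define e where "e = top_exp d x z"
  from True have "\<not> x + z \<ge> 2 ^ d - 1" by simp
  then have "E\<^sub>1 d x z = (if x mod 2 ^ e + z mod 2 ^ e < 2 ^ e - 1 then 2 else 1)"
    unfolding E\<^sub>1_def e_def Let_def by simp
  also have "\<dots> = (if x mod 2 ^ e + z mod 2 ^ e + 1 < 2 ^ e then 2 else 1)"
    by (simp add: less_diff_conv)
  also have "\<dots> = min 2 (carry_splits d x z)"
    using splits_invariant[OF assms] True unfolding Let_def e_def[symmetric]
    by (cases "x mod 2 ^ e + z mod 2 ^ e + 1" "(2 :: nat) ^ e" rule: linorder_cases) auto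
  finally show ?thesis .
next
  case False
  then have "E\<^sub>1 d x z = 0" by (auto simp: E\<^sub>1_def)
  moreover have "carry_splits d x z = 0" using splits_invariant[OF assms] False by (metis linorder_cases)
  ultimately show ?thesis by simp
qed

lemma O\<^sub>2_eq_even_count: "O\<^sub>2 d x z = even_count x z"
  by (auto simp: O\<^sub>2_def even_count_def)

text \<open>For \<open>2 ^ Suc d * y + 1\<close> the last digits give the factor
  \<open>even_count\<close>, and the halves are left with \<open>2 ^ d * y\<close>.\<close>

lemma O\<^sub>1_Suc_eq:
  assumes "x < 2 ^ Suc d" "z < 2 ^ Suc d"
  shows "O\<^sub>1 (Suc d) x z = min 2 (even_count x z * carry_splits d (x div 2) (z div 2))"
proof -
  define a b where ab: "a = x div 2" "b = z div 2"
  have lt: "a < 2 ^ d" "b < 2 ^ d" using assms unfolding ab by auto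
  note inv = splits_invariant[OF lt]
  have xz: "x = 2 * a + of_bool (odd x)" "z = 2 * b + of_bool (odd z)"
    unfolding ab by (simp_all add: mod2_eq_if[symmetric] flip: odd_iff_mod_2_eq_one)
  have pos: "(2::nat) ^ d \<ge> 1" by simp
  show ?thesis
  proof (cases "a + b + 1 < 2 ^ d")
    case False
    then have "carry_splits d a b = 0" using inv by (metis linorder_cases)
    \<comment> \<open>Two odd coordinates get label 0 by the threshold or by the parity rule; any
      others reach the threshold.\<close>
    moreover have "O\<^sub>1 (Suc d) x z = 0"
    proof (cases "odd x \<and> odd z")
      case True then show ?thesis by (auto simp: O\<^sub>1_def)
    next
      case F: False
      have "x + z \<ge> 2 ^ Suc d - 2" using xz False by simp
      then show ?thesis by (auto simp: O\<^sub>1_def)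
    qed
    ultimately show ?thesis by (simp add: ab)
  next
    case True
    then have ne: "common_zeros d a b \<noteq> {}" using inv by auto
    have c: "carry_splits d a b \<ge> 1"
      using True inv unfolding Let_def by (metis linorder_cases le_refl one_le_numeral order_trans)
    show ?thesis
    proof (cases "even (x + z)")
      case even: True
      \<comment> \<open>For an even sum the factor is 0 or 2, so a positive carry count already
        determines the truncated product.\<close>
      have "O\<^sub>1 (Suc d) x z = (if odd x then 0 else 2)"
      proof (cases "odd x")
        case True then show ?thesis using even by (simp add: O\<^sub>1_def)
      next
        case F: False
        then have "\<not> x + z \<ge> 2 ^ Suc d - 2" using xz even True pos by auto
        then show ?thesis using even F by (simp add: O\<^sub>1_def)
      qed
      then show ?thesis using even c by (auto simp: even_count_def ab)
    next
      case odd: False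
      define e where "e = top_exp d a b"
      have te: "top_exp (Suc d) x z = Suc e" using top_exp_Suc[of d x z] ne by (simp add: ab e_def)
      have "x + z = 2 * (a + b) + 1" using xz odd by auto
      then have "\<not> x + z \<ge> 2 ^ Suc d - 2" using True by auto
      \<comment> \<open>For an odd sum the factor is 1. The residues add up to
        \<open>2 * t + 1\<close>, which is below \<open>2 ^ Suc e - 1\<close> iff
        \<open>t < 2 ^ e - 1\<close>, the test of \<open>E\<^sub>1\<close> at the halves.\<close>
      then have "O\<^sub>1 (Suc d) x z =
          (if x mod 2 ^ Suc e + z mod 2 ^ Suc e < 2 ^ Suc e - 1 then 2 else 1)"
        using odd by (simp add: O\<^sub>1_def te)
      also have "x mod 2 ^ Suc e + z mod 2 ^ Suc e = 2 * (a mod 2 ^ e + b mod 2 ^ e) + 1"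
        unfolding mod_power_Suc ab using odd by (auto simp: odd_iff_mod_2_eq_one)
      also have "\<dots> < 2 ^ Suc e - 1 \<longleftrightarrow> a mod 2 ^ e + b mod 2 ^ e < 2 ^ e - 1" by auto
      also have "(if \<dots> then 2 else 1) = E\<^sub>1 d a b"
        using True by (auto simp: E\<^sub>1_def e_def)
      also have "\<dots> = min 2 (carry_splits d a b)" by (rule E\<^sub>1_eq_carry_splits[OF lt])
      also have "even_count x z = 1" using odd by (auto simp: even_count_def)
      then have "min 2 (carry_splits d a b) = min 2 (even_count x z * carry_splits d a b)" by simp
      finally show ?thesis by (simp add: ab)
    qed
  qed
qed

section \<open>The identities for c-Ulam\<close>

lemma hat_linear_combination:
  "hat_add (hat_mult (min 2 m) (min 2 b)) (hat_mult (min 2 n) c) = min 2 (n * c + b * m)"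
  if "c \<le> 2"
proof -
  \<comment> \<open>Truncation can wait until after the product: a factor 0 or 1 is unaffected by
    it, and two factors of at least 2 give 2 either way.\<close>
  have 1: "hat_mult (min 2 m) (min 2 b) = min 2 (b * m)" for m b :: nat
  proof (cases "m = 0 \<or> b = 0")
    case False
    then consider "m = 1" | "b = 1" | "m \<ge> 2" "b \<ge> 2" by linarith
    then show ?thesis
    proof cases
      case 3
      then have "b * m \<ge> 2 * 2" by (intro mult_mono) auto
      then show ?thesis using 3 by (simp add: hat_mult_def)
    qed (auto simp: hat_mult_def min_def)
  qed (auto simp: hat_mult_def)
  have "c = min 2 c" using that by simp
  then have "hat_mult (min 2 n) c = min 2 (c * n)" using 1 by metis
  then show ?thesis unfolding 1 hat_add_def by (auto simp: min_def mult.commute)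
qed

lemma cUlam_power:
  assumes "y > 0"
  shows "cUlam (2 ^ d * y) = (cUlam (y - 1) \<otimes>\<^bsub>d\<^esub> E\<^sub>1 d) \<oplus> (cUlam y \<otimes>\<^bsub>d\<^esub> E\<^sub>2 d)"
proof (intro ext)
  fix x z
  have "E\<^sub>1 d (x mod 2 ^ d) (z mod 2 ^ d) = min 2 (carry_splits d x z)"
    by (simp add: E\<^sub>1_eq_carry_splits carry_splits_mod)
  then show "cUlam (2 ^ d * y) x z = ((cUlam (y - 1) \<otimes>\<^bsub>d\<^esub> E\<^sub>1 d) \<oplus> (cUlam y \<otimes>\<^bsub>d\<^esub> E\<^sub>2 d)) x z"
    by (simp add: label_add_def label_tensor_def cUlam_eq_splits hat_linear_combination E\<^sub>2_def
        splits_power[OF assms])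
qed

text \<open>The last digit 1 is split off first, leaving \<open>2 ^ c * y\<close> at the halved
  coordinates, where \<open>d = Suc c\<close>.\<close>

lemma cUlam_power_plus_1:
  assumes "y > 0" "d > 0"
  shows "cUlam (2 ^ d * y + 1) = (cUlam (y - 1) \<otimes>\<^bsub>d\<^esub> O\<^sub>1 d) \<oplus> (cUlam y \<otimes>\<^bsub>d\<^esub> O\<^sub>2 d)"
proof (intro ext)
  fix x z
  obtain c where d: "d = Suc c" using assms(2) gr0_implies_Suc by blast
  define n where "n = even_count x z"
  have "n \<le> 2" by (simp add: n_def even_count_def)
  have 1: "O\<^sub>1 d (x mod 2 ^ d) (z mod 2 ^ d) = min 2 (n * carry_splits c (x div 2) (z div 2))"
    unfolding d n_def
    by (simp add: O\<^sub>1_Suc_eq even_count_mod mod_power_Suc_div_2 carry_splits_mod del: power_Suc)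
  have 2: "O\<^sub>2 d (x mod 2 ^ d) (z mod 2 ^ d) = n"
    unfolding d n_def by (simp add: O\<^sub>2_eq_even_count even_count_mod del: power_Suc)
  have "2 ^ d * y + 1 = 2 * (2 ^ c * y) + 1" by (simp add: d)
  then have "splits (2 ^ d * y + 1) x z = n * splits (2 ^ c * y) (x div 2) (z div 2)"
    by (simp only: splits_odd n_def)
  also have "\<dots> = splits y (x div 2 ^ d) (z div 2 ^ d) * n +
      (n * carry_splits c (x div 2) (z div 2)) * splits (y - 1) (x div 2 ^ d) (z div 2 ^ d)"
    using splits_power[OF assms(1), of c "x div 2" "z div 2"]
    by (simp only: d power_Suc div_mult2_eq) (simp only: algebra_simps)
  finally show "cUlam (2 ^ d * y + 1) x z = ((cUlam (y - 1) \<otimes>\<^bsub>d\<^esub> O\<^sub>1 d) \<oplus> (cUlam y \<otimes>\<^bsub>d\<^esub> O\<^sub>2 d)) x z"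
    using \<open>n \<le> 2\<close> by (simp only: label_add_def label_tensor_def cUlam_eq_splits hat_linear_combination 1 2)
qed

section \<open>Running an automaton on a Turing machine\<close>

text \<open>The run of the automaton from state \<open>s\<close> over the digit pairs, top digits
  first: the recursion strips the lowest pair, which is read last.\<close>

fun scan :: "(nat \<Rightarrow> nat \<Rightarrow> nat \<Rightarrow> nat) \<Rightarrow> nat \<Rightarrow> nat \<Rightarrow> nat \<Rightarrow> nat \<Rightarrow> nat" where
  "scan \<delta> s 0 x z = s"
| "scan \<delta> s (Suc d) x z = \<delta> (scan \<delta> s d (x div 2) (z div 2)) (x mod 2) (z mod 2)"

text \<open>State 0 copies the digits of \<open>x\<close> to the second tape, state 1 rewinds that tape, and
  state \<open>q + 2\<close> reads the digits of \<open>x\<close> and \<open>z\<close> in parallel, the automaton being in state \<open>q\<close>.\<close>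

definition scan_tm :: "(nat \<Rightarrow> nat \<Rightarrow> nat \<Rightarrow> nat) \<Rightarrow> nat \<Rightarrow> nat \<Rightarrow> (nat \<Rightarrow> nat) \<Rightarrow> tm" where
  "scan_tm \<delta> s k f = \<lparr>ntapes = 3, nsyms = 5, nstates = k + 2, trans_fun = \<lambda>q ss.
     if q = 0 then
       if ss ! 0 = 4 then (1, [(4, Stay), (0, Left), (0, Stay)])
       else (0, [(ss ! 0, Right), (ss ! 0, Right), (0, Stay)])
     else if q = 1 then
       if ss ! 1 = 0 then (s + 2, [(ss ! 0, Right), (0, Right), (0, Stay)])
       else (1, [(ss ! 0, Stay), (ss ! 1, Left), (0, Stay)])
     else
       if ss ! 0 = 0 then (k + 2, [(0, Stay), (ss ! 1, Stay), (Suc (f (q - 2)), Stay)])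
       else (\<delta> (q - 2) (ss ! 1 - 1) (ss ! 0 - 1) + 2,
         [(ss ! 0, Right), (ss ! 1, Right), (0, Stay)])\<rparr>"

lemma wf_scan_tm:
  assumes "s < k" "\<And>q i j. q < k \<Longrightarrow> \<delta> q i j < k" "\<And>q. q < k \<Longrightarrow> f q \<le> 2"
  shows "wf_tm (scan_tm \<delta> s k f)"
proof -
  have len: "length ss = 3 \<longleftrightarrow> (\<exists>a b c. ss = [a, b, c])" for ss :: "nat list"
    by (auto simp: length_Suc_conv numeral_3_eq_3)
  have "\<delta> (q - 2) i j \<le> k" "f (q - 2) < 4" if "q < k + 2" "q \<noteq> 0" "q \<noteq> Suc 0" for q i j
  proof -
    have "q - 2 < k" using that by linarith
    from assms(2)[OF this, of i j] assms(3)[OF this]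
    show "\<delta> (q - 2) i j \<le> k" "f (q - 2) < 4" by simp_all
  qed
  then show ?thesis using assms(1)
    by (auto simp: wf_tm_def scan_tm_def len)
qed

lemma contents_update_take:
  "n < length w \<Longrightarrow> (contents (take n w))(int n := w ! n) = contents (take (Suc n) w)"
  by (auto simp: contents_def fun_eq_iff take_Suc_conv_app_nth nth_append min_def)

lemma contents_nth [simp]: "n < length w \<Longrightarrow> contents w (int n) = w ! n"
  by (simp add: contents_def)

lemma contents_outside: "i < 0 \<or> i \<ge> int (length w) \<Longrightarrow> contents w i = 0"
  by (auto simp: contents_def)

text \<open>Each of the three phases takes \<open>d\<close> steps for the digits and one more to
  notice its end.\<close>

lemma scan_tm_run:
  fixes a b :: "nat list" and \<delta> f and d k s :: nat
  defines "w \<equiv> a @ [4] @ b"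
  defines "M \<equiv> scan_tm \<delta> s k f"
  assumes len: "length a = d" "length b = d"
    and sym: "set a \<subseteq> {1, 2}" "set b \<subseteq> {1, 2}"
    and wf: "s < k" "\<And>q i j. q < k \<Longrightarrow> \<delta> q i j < k"
  shows "computes_within M w (3 * d + 3)
    [Suc (f (foldl (\<lambda>q (i, j). \<delta> q (i - 1) (j - 1)) s (zip a b)))]"
proof -
  have nst: "nstates M = k + 2" by (simp add: M_def scan_tm_def)
  have symn: "a ! n \<noteq> 0" "a ! n \<noteq> 4" "b ! n \<noteq> 0" if "n < d" for n
  proof -
    have "a ! n \<in> {1, 2}" "b ! n \<in> {1, 2}"
      using sym len that by (metis nth_mem subsetD)+
    then show "a ! n \<noteq> 0" "a ! n \<noteq> 4" "b ! n \<noteq> 0" by auto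
  qed
  define e where "e = (contents [], 0 :: int)"
  define g where "g = (\<lambda>q (i, j). \<delta> q (i - 1) (j - 1))"
  define st where "st n = foldl g s (take n (zip a b))" for n
  have blank: "(contents [])(0 := 0) = contents []"
    by (auto simp: contents_def)
  have init: "init M w = (0, [(contents w, 0), (contents [], 0), e])"
    by (simp add: init_def M_def scan_tm_def e_def numeral_2_eq_2)
  have cw: "contents w (int n) = w ! n" if "n \<le> 2 * d" for n
    using that len by (intro contents_nth) (simp add: w_def)
  have A: "(step M ^^ n) (init M w) = (0, [(contents w, int n), (contents (take n a), int n), e])"
    if "n \<le> d" for n
    using that
  proof (induction n)
    case 0 then show ?case by (simp add: init)
  next
    case (Suc n)
    have "contents w (int n) = a ! n" using cw[of n] Suc.prems len by (simp add: w_def nth_append)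
    moreover have "a ! n \<noteq> 4" using symn Suc.prems by simp
    \<comment> \<open>The first tape is overwritten with the symbol just read, so
      \<open>fun_upd_triv\<close> keeps its contents.\<close>
    ultimately show ?case
      using Suc len contents_update_take[of n a] fun_upd_triv[of "contents w" "int n"]
      by (simp add: M_def scan_tm_def e_def blank contents_outside ac_simps)
  qed
  have cwd: "contents w (int d) = 4" using cw[of d] len by (simp add: w_def nth_append)
  have A': "(step M ^^ (d + 1)) (init M w) = (1, [(contents w, int d), (contents a, int d - 1), e])"
    using A[of d] len cwd fun_upd_triv[of "contents w" "int d"] fun_upd_triv[of "contents a" "int d"]
    by (simp add: M_def scan_tm_def e_def blank contents_outside)
  have B: "(step M ^^ n) (1, [(contents w, int d), (contents a, int d - 1), e]) =
      (1, [(contents w, int d), (contents a, int d - 1 - int n), e])" if "n \<le> d" for n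
    using that
  proof (induction n)
    case (Suc n)
    have p: "int d - 1 - int n = int (d - 1 - n)" using Suc.prems by simp
    have "contents a (int d - 1 - int n) = a ! (d - 1 - n)"
      unfolding p using Suc.prems len by (intro contents_nth) simp
    moreover have "a ! (d - 1 - n) \<noteq> 0" using symn Suc.prems by simp
    ultimately show ?case
      using Suc fun_upd_triv[of "contents w" "int d"]
        fun_upd_triv[of "contents a" "int d - 1 - int n"]
      by (simp add: M_def scan_tm_def e_def blank contents_outside algebra_simps)
  qed simp
  \<comment> \<open>The blank at position -1 ends the rewinding; the second head returns to 0 and
    the first passes the separator.\<close>
  have B': "(step M ^^ (d + 1)) (1, [(contents w, int d), (contents a, int d - 1), e]) =
      (s + 2, [(contents w, int d + 1), (contents a, 0), e])"
    using B[of d] cwd fun_upd_triv[of "contents w" "int d"] fun_upd_triv[of "contents a" "-1"]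
    by (simp add: M_def scan_tm_def e_def blank contents_outside)
  have st: "st n < k" for n
  proof (induction n)
    case 0 then show ?case using wf by (simp add: st_def)
  next
    case (Suc n)
    then show ?case using wf(2)
      by (cases "n < length (zip a b)")
        (auto simp: st_def take_Suc_conv_app_nth g_def split: prod.split)
  qed
  \<comment> \<open>Entry \<open>n\<close> of \<open>b\<close> lies at \<open>d + 1 + n\<close>,
    past \<open>a\<close> and the separator, so the heads read corresponding entries.\<close>
  have C: "(step M ^^ n) (s + 2, [(contents w, int d + 1), (contents a, 0), e]) =
      (st n + 2, [(contents w, int d + 1 + int n), (contents a, int n), e])" if "n \<le> d" for n
    using that
  proof (induction n)
    case 0 then show ?case by (simp add: st_def)
  next
    case (Suc n)
    have p: "int d + 1 + int n = int (d + 1 + n)" by simp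
    have "contents w (int d + 1 + int n) = b ! n"
      unfolding p using cw[of "d + 1 + n"] Suc.prems len by (simp add: w_def nth_append)
    moreover have "b ! n \<noteq> 0" using symn Suc.prems by simp
    moreover have "st (Suc n) = \<delta> (st n) (a ! n - 1) (b ! n - 1)"
      using Suc.prems len by (simp add: st_def take_Suc_conv_app_nth g_def)
    ultimately show ?case
      using Suc len st[of n] contents_nth[of n a] fun_upd_triv[of "contents w" "int d + 1 + int n"]
        fun_upd_triv[of "contents a" "int n"]
      by (simp add: M_def scan_tm_def e_def blank contents_outside algebra_simps)
  qed
  have out: "(contents [])(0 := v) = contents [v]" for v
    by (auto simp: contents_def fun_eq_iff)
  have "contents w (int d + 1 + int d) = 0"
    using len by (intro contents_outside) (simp add: w_def)
  then have C': "\<exists>t1 t2. (step M ^^ (d + 1)) (s + 2, [(contents w, int d + 1), (contents a, 0), e]) =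
      (k + 2, [t1, t2, (contents [Suc (f (st d))], 0)])"
    using C[of d] st[of d] out by (simp add: M_def scan_tm_def e_def)
  have "(step M ^^ ((d + 1) + ((d + 1) + (d + 1)))) (init M w) =
      (step M ^^ (d + 1)) ((step M ^^ (d + 1)) ((step M ^^ (d + 1)) (init M w)))"
    by (simp only: funpow_add o_apply)
  then obtain t1 t2 where
    "(step M ^^ ((d + 1) + ((d + 1) + (d + 1)))) (init M w) =
      (k + 2, [t1, t2, (contents [Suc (f (st d))], 0)])"
    unfolding A' B' using C' by auto
  moreover have "st d = foldl g s (zip a b)" using len by (simp add: st_def)
  ultimately show ?thesis unfolding computes_within_def nst g_def
    by (intro exI[of _ "(d + 1) + ((d + 1) + (d + 1))"]) auto
qed

section \<open>From digit lists to recursion on numbers\<close>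

lemma length_digits [simp]: "length (digits d n) = d"
  by (simp add: digits_def)

lemma digits_Suc: "digits (Suc d) n = digits d (n div 2) @ [n mod 2]"
proof -
  have "rev [0..<Suc d] = map Suc (rev [0..<d]) @ [0]"
    by (simp add: rev_map map_Suc_upt upt_conv_Cons flip: rev_map)
  then show ?thesis by (simp add: digits_def div_mult2_eq del: upt_Suc)
qed

lemma foldl_digits_eq_scan:
  "foldl (\<lambda>q (i, j). \<delta> q (i - 1) (j - 1)) s
     (zip (map Suc (digits d x)) (map Suc (digits d z))) = scan \<delta> s d x z"
proof (induction d arbitrary: x z)
  case 0 then show ?case by (simp add: digits_def)
qed (simp add: digits_Suc)

text \<open>Reduces the time bound to exhibiting a finite automaton whose final state determines the
  label through \<open>f\<close>.\<close>

lemma linear_time_computable_scan: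
  assumes "s < k" "\<And>q i j. q < k \<Longrightarrow> \<delta> q i j < k" "\<And>q. q < k \<Longrightarrow> f q \<le> 2"
    and F: "\<And>d x z. d \<ge> 1 \<Longrightarrow> x < 2 ^ d \<Longrightarrow> z < 2 ^ d \<Longrightarrow> F d x z = f (scan \<delta> s d x z)"
  shows "linear_time_computable F"
  unfolding linear_time_computable_def
proof (intro exI[of _ "scan_tm \<delta> s k f"] exI[of _ "\<lambda>d. 3 * d + 3"] conjI allI impI)
  show "wf_tm (scan_tm \<delta> s k f)" using assms(1-3) by (rule wf_scan_tm)
  \<comment> \<open>From \<open>d = 1\<close> on, \<open>3 * d + 3\<close> is at most
    \<open>6 * d\<close>.\<close>
  show "(\<lambda>d. real (3 * d + 3)) \<in> O(\<lambda>d. real d)"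
    by (rule bigoI[of _ 6]) (auto intro!: eventually_at_top_linorderI[of 1])
next
  fix d x z :: nat assume "1 \<le> d" "x < 2 ^ d" "z < 2 ^ d"
  have "set (map Suc (digits d n)) \<subseteq> {1, 2}" for n by (auto simp: digits_def)
  then show "computes_within (scan_tm \<delta> s k f) (encode d x z) (3 * d + 3) [Suc (F d x z)]"
    unfolding encode_def F[OF \<open>1 \<le> d\<close> \<open>x < 2 ^ d\<close> \<open>z < 2 ^ d\<close>] foldl_digits_eq_scan[symmetric]
    using assms(1-2) by (intro scan_tm_run) auto
qed

section \<open>Automata for the labelings\<close>

lemma even_count_mod_2 [simp]: "even_count (x mod 2) (z mod 2) = even_count x z"
  by (simp add: even_count_def)

lemma even_count_le_2: "even_count x z \<le> 2"
  by (simp add: even_count_def)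

lemma ternary_digit:
  "(3 * a + min 2 b) div 3 = a" "(3 * a + min 2 b) mod 3 = min 2 b" for a b :: nat
  by (simp_all add: min_def)

text \<open>Truncated counts suffice to compute truncated counts, which keeps the automaton
  finite.\<close>

lemma min_2_mult: "min 2 (n * min 2 m) = min 2 (n * m)" for m n :: nat
  by (cases n) (auto simp: min_def)

lemma min_2_add_mult: "min 2 (min 2 k + n * min 2 m) = min 2 (k + n * m)" for k m n :: nat
  using min_2_mult[of n m] by (auto simp: min_def split: if_splits)

text \<open>The state encodes \<open>carry_splits\<close> and \<open>full_splits\<close>, truncated at 2, as two ternary digits.\<close>

definition carry_step :: "nat \<Rightarrow> nat \<Rightarrow> nat \<Rightarrow> nat" where
  "carry_step q i j = 3 * min 2 (q div 3 + of_bool (even i \<and> even j) * (q mod 3)) +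
     min 2 (even_count i j * (q mod 3))"

lemma carry_step_less: "carry_step q i j < 9"
  by (auto simp: carry_step_def min_def)

lemma carry_step_encode:
  "carry_step (3 * min 2 a + min 2 b) i j =
    3 * min 2 (a + of_bool (even i \<and> even j) * b) + min 2 (even_count i j * b)"
  unfolding carry_step_def ternary_digit min_2_mult min_2_add_mult ..

text \<open>The start state 1 is \<open>3 * 0 + 1\<close>, encoding the two counts for no
  digits.\<close>

lemma scan_carry_step:
  "scan carry_step 1 d x z = 3 * min 2 (carry_splits d x z) + min 2 (full_splits d x z)"
proof (induction d arbitrary: x z)
  case (Suc d)
  show ?case by (simp only: scan.simps Suc carry_step_encode) simp
qed simp

lemma linear_time_computable_E\<^sub>1: "linear_time_computable E\<^sub>1"
\<comment> \<open>Two ternary digits make 9 states; the leading one is the label.\<close>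
proof (rule linear_time_computable_scan[where k = 9])
  fix d x z :: nat assume "x < 2 ^ d" "z < 2 ^ d"
  then show "E\<^sub>1 d x z = scan carry_step 1 d x z div 3"
    by (simp add: E\<^sub>1_eq_carry_splits scan_carry_step[simplified] min_def)
qed (use carry_step_less in auto)

lemma linear_time_computable_E\<^sub>2: "linear_time_computable E\<^sub>2"
  by (rule linear_time_computable_scan[where s = 0 and k = 1 and \<delta> = "\<lambda>_ _ _. 0" and f = "\<lambda>_. 1"])
    (auto simp: E\<^sub>2_def)

text \<open>\<open>O\<^sub>1 d x z\<close> depends on \<open>carry_splits\<close> of all digits but the last, so a third ternary digit holds
  the value of \<open>O\<^sub>1\<close> that would be output after the current digits.\<close>

definition odd_step :: "nat \<Rightarrow> nat \<Rightarrow> nat \<Rightarrow> nat" where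
  "odd_step q i j = 3 * carry_step (q div 3) i j + min 2 (even_count i j * (q div 3 div 3))"

lemma odd_step_less: "odd_step q i j < 27"
proof -
  have "min 2 (even_count i j * (q div 3 div 3)) < 3" by simp
  then show ?thesis using carry_step_less[of "q div 3" i j] unfolding odd_step_def by linarith
qed

lemma odd_step_digits:
  "odd_step q i j div 3 = carry_step (q div 3) i j"
  "odd_step q i j mod 3 = min 2 (even_count i j * (q div 3 div 3))"
  unfolding odd_step_def ternary_digit by (rule refl)+

text \<open>The start state 3 is \<open>3 * 1 + 0\<close>, the start state of
  \<open>carry_step\<close> followed by a digit 0.\<close>

lemma scan_odd_step_div_3: "scan odd_step 3 d x z div 3 = scan carry_step 1 d x z"
  by (induction d arbitrary: x z) (simp_all add: odd_step_digits)

lemma linear_time_computable_O\<^sub>1: "linear_time_computable O\<^sub>1"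
proof (rule linear_time_computable_scan[where k = 27])
  fix d x z :: nat assume "d \<ge> 1" and less: "x < 2 ^ d" "z < 2 ^ d"
  then obtain c where d: "d = Suc c" by (cases d) auto
  have "scan odd_step 3 d x z mod 3 =
      min 2 (even_count x z * (scan carry_step 1 c (x div 2) (z div 2) div 3))"
    unfolding d scan.simps odd_step_digits scan_odd_step_div_3 even_count_mod_2 ..
  also have "\<dots> = O\<^sub>1 d x z"
    unfolding scan_carry_step ternary_digit min_2_mult d O\<^sub>1_Suc_eq[OF less[unfolded d]] ..
  finally show "O\<^sub>1 d x z = scan odd_step 3 d x z mod 3" ..
qed (use odd_step_less in auto)

text \<open>The label depends on the last pair alone, so the state just stores the
  \<open>even_count\<close> of the pair read.\<close>

lemma linear_time_computable_O\<^sub>2: "linear_time_computable O\<^sub>2"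
proof (rule linear_time_computable_scan[where s = 0 and k = 3 and
      \<delta> = "\<lambda>_. even_count" and f = "\<lambda>q. q"])
  fix d x z :: nat assume "d \<ge> 1"
  then show "O\<^sub>2 d x z = scan (\<lambda>_. even_count) 0 d x z"
    by (cases d) (simp_all add: O\<^sub>2_eq_even_count)
qed (use even_count_le_2 in \<open>auto simp: less_Suc_eq_le numeral_3_eq_3 numeral_2_eq_2\<close>)

theorem theorem1p11:
  shows "linear_time_computable E\<^sub>1 \<and> linear_time_computable E\<^sub>2 \<and>
         linear_time_computable O\<^sub>1 \<and> linear_time_computable O\<^sub>2 \<and>
         (\<forall>d y :: nat. d \<ge> 1 \<longrightarrow> odd y \<longrightarrow>
            cUlam (2 ^ d * y) = (cUlam (y - 1) \<otimes>\<^bsub>d\<^esub> E\<^sub>1 d) \<oplus> (cUlam y \<otimes>\<^bsub>d\<^esub> E\<^sub>2 d) \<and>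
            cUlam (2 ^ d * y + 1) = (cUlam (y - 1) \<otimes>\<^bsub>d\<^esub> O\<^sub>1 d) \<oplus> (cUlam y \<otimes>\<^bsub>d\<^esub> O\<^sub>2 d))"
proof (intro conjI allI impI)
  fix d y :: nat assume "d \<ge> 1" "odd y"
  then have pos: "y > 0" "d > 0" by (auto intro: odd_pos)
  show "cUlam (2 ^ d * y) = (cUlam (y - 1) \<otimes>\<^bsub>d\<^esub> E\<^sub>1 d) \<oplus> (cUlam y \<otimes>\<^bsub>d\<^esub> E\<^sub>2 d)"
    using pos(1) by (rule cUlam_power)
  show "cUlam (2 ^ d * y + 1) = (cUlam (y - 1) \<otimes>\<^bsub>d\<^esub> O\<^sub>1 d) \<oplus> (cUlam y \<otimes>\<^bsub>d\<^esub> O\<^sub>2 d)"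
    using pos by (rule cUlam_power_plus_1)
qed (fact linear_time_computable_E\<^sub>1 linear_time_computable_E\<^sub>2
  linear_time_computable_O\<^sub>1 linear_time_computable_O\<^sub>2)+

end
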